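(* For every real number $D>1$, every positive integer $n$, and every norm $\|\cdot\|$ on $\mathbb{R}^n$, the following holds: if $S\subset\mathbb{R}^n$, equipped with the metric $d(x,y)=\|x-y\|$, has ultrametric distortion $c_{\mathrm{UM}}(S,d)\le D$, then its Hausdorff dimension satisfies $$\dim_H(S)\le\Bigl(1-\frac{1}{2(D+1)}\Bigr)n .$$
   Context: An ultrametric on a set $X$ is a metric $\rho$ on $X$ satisfying $\rho(x,y)\le\max\{\rho(x,z),\rho(y,z)\}$ for all $x,y,z\in X$. The ultrametric distortion of a metric space $(X,d)$, written $c_{\mathrm{UM}}(X,d)$, is the infimum over $D$ such that there exists an ultrametric $\rho$ on $X$ satisfying $d(x,y)\le\rho(x,y)\le D\cdot d(x,y)$ for all $x,y\in X$ (the infimum is $+\infty$ if no such $D$ exists). The diameter is $\operatorname{diam}(X)=\sup_{x,y\in X}d(x,y)$. For $\alpha>0$, the $\alpha$-Hausdorff content of $(X,d)$ is $\mathcal{C}^\alpha(X)=\inf\{\sum_{i\in\mathbb{N}}\operatorname{diam}(A_i)^\alpha:\ \bigcup_{i\in\mathbb{N}}A_i\supseteq X\}$, and the Hausdorff dimension is $\dim_H(X)=\inf\{\alpha>0:\ \mathcal{C}^\alpha(X)=0\}$. *)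

theory Defs
  imports "HOL-Analysis.Analysis"
begin

text \<open>
  A metric space is a pair of a carrier \<open>X\<close> and a distance function \<open>d\<close>, as in the
  library locale \<^locale>\<open>Metric_space\<close>; only values of \<open>d\<close> on \<open>X\<close> matter below.
\<close>

definition ultrametric_on :: "'a set \<Rightarrow> ('a \<Rightarrow> 'a \<Rightarrow> real) \<Rightarrow> bool" where
  "ultrametric_on X \<rho> \<longleftrightarrow>
     Metric_space X \<rho> \<and>
     (\<forall>x\<in>X. \<forall>y\<in>X. \<forall>z\<in>X. \<rho> x y \<le> max (\<rho> x z) (\<rho> y z))"

text \<open>
  The restriction \<open>D \<ge> 1\<close> is automatic as soon as \<open>X\<close> has two distinct points; for spaces
  with at most one point it normalises the infimum to \<open>1\<close>. The infimum of the empty set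
  is \<open>\<infinity>\<close> in the extended reals.
\<close>

definition ultrametric_distortion :: "'a set \<Rightarrow> ('a \<Rightarrow> 'a \<Rightarrow> real) \<Rightarrow> ereal" where
  "ultrametric_distortion X d =
     Inf {ereal D | D. D \<ge> 1 \<and>
       (\<exists>\<rho>. ultrametric_on X \<rho> \<and>
            (\<forall>x\<in>X. \<forall>y\<in>X. d x y \<le> \<rho> x y \<and> \<rho> x y \<le> D * d x y))}"

text \<open>
  The library's \<^const>\<open>diameter\<close> is tied to the type-class distance and is real-valued;
  here unbounded sets have infinite diameter. The supremum over the empty set is \<open>0\<close>
  in \<^typ>\<open>ennreal\<close>.
\<close>

definition ediam :: "('a \<Rightarrow> 'a \<Rightarrow> real) \<Rightarrow> 'a set \<Rightarrow> ennreal" where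
  "ediam d A = (SUP x\<in>A. SUP y\<in>A. ennreal (d x y))"

text \<open>Meant for exponents \<open>\<alpha> > 0\<close>, where \<open>0\<close> goes to \<open>0\<close> and \<open>\<infinity>\<close> to \<open>\<infinity>\<close>.\<close>

definition epowr :: "ennreal \<Rightarrow> real \<Rightarrow> ennreal" where
  "epowr t \<alpha> = (if t = \<infinity> then \<infinity> else ennreal (enn2real t powr \<alpha>))"

definition hausdorff_content :: "real \<Rightarrow> 'a set \<Rightarrow> ('a \<Rightarrow> 'a \<Rightarrow> real) \<Rightarrow> ennreal" where
  "hausdorff_content \<alpha> X d =
     Inf {(\<Sum>i. epowr (ediam d (A i)) \<alpha>) | A :: nat \<Rightarrow> 'a set.
            (\<forall>i. A i \<subseteq> X) \<and> X \<subseteq> (\<Union>i. A i)}"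

definition hausdorff_dim :: "'a set \<Rightarrow> ('a \<Rightarrow> 'a \<Rightarrow> real) \<Rightarrow> ereal" where
  "hausdorff_dim X d = Inf {ereal \<alpha> | \<alpha>. \<alpha> > 0 \<and> hausdorff_content \<alpha> X d = 0}"

text \<open>
  An arbitrary norm on a real vector space. The class constant \<^const>\<open>norm\<close> is not usable,
  since on \<open>real ^ 'n\<close> it is the Euclidean norm.
\<close>

definition is_norm :: "('a::real_vector \<Rightarrow> real) \<Rightarrow> bool" where
  "is_norm N \<longleftrightarrow>
     (\<forall>x. 0 \<le> N x) \<and>
     (\<forall>x. N x = 0 \<longleftrightarrow> x = 0) \<and>
     (\<forall>c x. N (c *\<^sub>R x) = \<bar>c\<bar> * N x) \<and>
     (\<forall>x y. N (x + y) \<le> N x + N y)"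

end

theory Submission
  imports Defs
begin

text \<open>
  The idea is to follow the Lebesgue measure \<open>f t\<close> of the \<open>t\<close>-neighbourhood, in the given
  norm, of a bounded part \<open>U\<close> of \<open>S\<close>. Let \<open>\<rho>\<close> be an ultrametric with
  \<open>d \<le> \<rho> \<le> K d\<close>, let \<open>q > 1\<close>, and cut \<open>U\<close> into the \<open>\<rho>\<close>-balls of
  radius \<open>2 K q t\<close>. Different balls are disjoint and even at \<open>d\<close>-distance at least
  \<open>2 q t\<close>, so their \<open>q t\<close>-neighbourhoods are disjoint, and \<open>f t\<close> and \<open>f (q t)\<close> are
  sums over these clusters. On the other hand a cluster is small: its \<open>t\<close>-neighbourhood lies
  within \<open>(2 K q + 1) t\<close> of any of its points. Dilating this neighbourhood
  about such a point by the factor \<open>1 + (q - 1) / (2 K q + 1)\<close> moves no point by more than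
  \<open>(q - 1) t\<close>, so the result stays in the \<open>q t\<close>-neighbourhood
  (\<open>emeasure_nbhd_dilate\<close>). This dilation replaces the Brunn--Minkowski inequality. Writing
  \<open>n\<close> for the dimension of the space and summing over the clusters
  (\<open>emeasure_nbhd_growth\<close>),

  \<open>f (q t) \<ge> (1 + (q - 1) / (2 K q + 1)) ^ n * f t\<close>.

  For \<open>K = D + 1/4\<close> and \<open>q = (2 D + 1) / (2 K)\<close> the denominator is exactly
  \<open>2 (D + 1)\<close>. With \<open>a = 1 / (2 (D + 1))\<close>, Bernoulli's inequality
  \<open>q powr a \<le> 1 + a (q - 1)\<close> shows that the factor is at least \<open>q powr (a n)\<close>, hence
  \<open>f t\<close> is at most a constant times \<open>t powr (a n)\<close> along \<open>t = q ^ (- k)\<close>.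

  At scale \<open>t\<close> the number of clusters times the volume of a ball of radius \<open>t\<close> is at most
  \<open>f t\<close>, so the clusters are a cover whose \<open>\<alpha>\<close>-cost is of order at most
  \<open>t powr (\<alpha> - n + a n)\<close> (\<open>hausdorff_content_le_emeasure_nbhd\<close>). This tends to
  \<open>0\<close> as soon as \<open>\<alpha> > (1 - a) n\<close>. Countable subadditivity removes the restriction to
  bounded sets.
\<close>

section \<open>Norms on Euclidean spaces\<close>

lemma is_norm_zero: "is_norm N \<Longrightarrow> N 0 = 0"
  by (simp add: is_norm_def)

lemma is_norm_nonneg: "is_norm N \<Longrightarrow> 0 \<le> N x"
  by (simp add: is_norm_def)

lemma is_norm_pos: "is_norm N \<Longrightarrow> x \<noteq> 0 \<Longrightarrow> 0 < N x"
  by (metis is_norm_def less_eq_real_def)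

lemma is_norm_scaleR: "is_norm N \<Longrightarrow> N (c *\<^sub>R x) = \<bar>c\<bar> * N x"
  by (simp add: is_norm_def)

lemma is_norm_triangle: "is_norm N \<Longrightarrow> N (x + y) \<le> N x + N y"
  by (simp add: is_norm_def)

lemma is_norm_minus_commute: "is_norm N \<Longrightarrow> N (x - y) = N (y - x)"
  using is_norm_scaleR[of N "-1" "x - y"] by simp

lemma is_norm_triangle_diff: "is_norm N \<Longrightarrow> N (x - z) \<le> N (x - y) + N (y - z)"
  using is_norm_triangle[of N "x - y" "y - z"] by simp

lemma is_norm_sum_le:
  assumes "is_norm N"
  shows "N (sum f A) \<le> (\<Sum>i\<in>A. N (f i))"
proof (induction A rule: infinite_finite_induct)
  case (insert x F)
  then show ?case using is_norm_triangle[OF assms, of "f x" "sum f F"] by simp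
qed (simp_all add: is_norm_zero[OF assms])

lemma is_norm_le_norm:
  fixes N :: "'a::euclidean_space \<Rightarrow> real"
  assumes "is_norm N"
  obtains C where "C > 0" "\<And>x. N x \<le> C * norm x"
proof
  have nn: "(\<Sum>b\<in>Basis. N b) \<ge> 0"
    by (simp add: is_norm_nonneg[OF assms] sum_nonneg)
  then show "1 + (\<Sum>b\<in>Basis. N b) > 0" by linarith
  fix x :: 'a
  have "N x = N (\<Sum>b\<in>Basis. (x \<bullet> b) *\<^sub>R b)" by (simp add: euclidean_representation)
  also have "\<dots> \<le> (\<Sum>b\<in>Basis. N ((x \<bullet> b) *\<^sub>R b))" by (rule is_norm_sum_le[OF assms])
  also have "\<dots> \<le> (\<Sum>b\<in>Basis. norm x * N b)"
    by (intro sum_mono) (auto simp: is_norm_scaleR[OF assms] Basis_le_norm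
        intro!: mult_right_mono is_norm_nonneg[OF assms])
  also have "\<dots> = (\<Sum>b\<in>Basis. N b) * norm x" by (simp add: sum_distrib_left mult.commute)
  finally show "N x \<le> (1 + (\<Sum>b\<in>Basis. N b)) * norm x"
    using norm_ge_zero[of x] unfolding distrib_right by linarith
qed

lemma is_norm_continuous:
  fixes N :: "'a::euclidean_space \<Rightarrow> real"
  assumes "is_norm N"
  shows "continuous_on A N"
proof -
  obtain C where C: "C > 0" "\<And>x. N x \<le> C * norm x" using is_norm_le_norm[OF assms] by blast
  have "\<bar>N x - N y\<bar> \<le> C * norm (x - y)" for x y
    using is_norm_triangle[OF assms, of "x - y" y] is_norm_triangle[OF assms, of "y - x" x]
      is_norm_minus_commute[OF assms, of x y] C(2)[of "x - y"] by simp
  then have "C-lipschitz_on A N"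
    using C(1) by (intro lipschitz_onI) (auto simp: dist_norm)
  then show ?thesis by (rule lipschitz_on_continuous_on)
qed

text \<open>
  On the compact Euclidean unit sphere \<open>N\<close> attains a minimum, which is positive; homogeneity
  carries the resulting bound to all vectors.
\<close>

lemma norm_le_is_norm:
  fixes N :: "'a::euclidean_space \<Rightarrow> real"
  assumes "is_norm N"
  obtains C where "C > 0" "\<And>x. norm x \<le> C * N x"
proof -
  have "sphere (0::'a) 1 \<noteq> {}" by simp
  then obtain u where u: "norm u = 1" "\<And>y. norm y = 1 \<Longrightarrow> N u \<le> N y"
    using continuous_attains_inf[OF compact_sphere _ is_norm_continuous[OF assms], of 0 1]
    by (auto simp: sphere_def)
  have pos: "N u > 0" using is_norm_pos[OF assms, of u] u(1) by force
  show thesis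
  proof (rule that[of "1 / N u"])
    fix x :: 'a
    show "norm x \<le> 1 / N u * N x"
    proof (cases "x = 0")
      case False
      then have "N u \<le> N (x /\<^sub>R norm x)" by (intro u(2)) simp
      also have "\<dots> = N x / norm x" using False by (simp add: is_norm_scaleR[OF assms] divide_inverse)
      finally show ?thesis using False pos by (simp add: field_simps)
    qed (simp add: is_norm_zero[OF assms])
  qed (use pos in simp)
qed

section \<open>Volumes of neighbourhoods\<close>

definition nbhd :: "('a::real_vector \<Rightarrow> real) \<Rightarrow> 'a set \<Rightarrow> real \<Rightarrow> 'a set" where
  "nbhd N A t = (\<Union>y\<in>A. {z. N (z - y) < t})"

lemma nbhd_Union: "nbhd N (\<Union>P) t = (\<Union>C\<in>P. nbhd N C t)"
  by (auto simp: nbhd_def)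

lemma open_nbhd:
  fixes N :: "'a::euclidean_space \<Rightarrow> real"
  assumes "is_norm N"
  shows "open (nbhd N A t)"
  unfolding nbhd_def
proof (intro open_UN ballI open_Collect_less)
  fix y :: 'a
  show "continuous_on UNIV (\<lambda>z. N (z - y))"
    by (rule continuous_on_compose2[OF is_norm_continuous[OF assms, of UNIV]])
      (auto intro!: continuous_intros)
qed simp

lemma sets_nbhd:
  fixes N :: "'a::euclidean_space \<Rightarrow> real"
  shows "is_norm N \<Longrightarrow> nbhd N A t \<in> sets lebesgue"
  by (simp add: open_nbhd borel_open)

lemma emeasure_nbhd_finite:
  fixes N :: "'a::euclidean_space \<Rightarrow> real"
  assumes "is_norm N" "bounded A"
  shows "emeasure lebesgue (nbhd N A t) < \<infinity>"
proof -
  obtain C where C: "C > 0" "\<And>x. norm x \<le> C * N x" using norm_le_is_norm[OF assms(1)] by blast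
  obtain B where B: "\<And>y. y \<in> A \<Longrightarrow> norm y \<le> B" using assms(2) by (auto simp: bounded_iff)
  have "norm z \<le> B + C * t" if "y \<in> A" "N (z - y) < t" for y z
  proof -
    have "norm z \<le> norm y + norm (z - y)" using norm_triangle_ineq[of y "z - y"] by simp
    also have "\<dots> \<le> B + C * N (z - y)" using B C(2) that(1) by (intro add_mono) auto
    also have "\<dots> \<le> B + C * t" using that(2) C(1) by simp
    finally show ?thesis .
  qed
  then have "bounded (nbhd N A t)"
    unfolding bounded_iff nbhd_def by blast
  then show ?thesis
    using fmeasurableD2[OF bounded_set_imp_lmeasurable[OF _ sets_nbhd[OF assms(1)]]]
    by (simp add: top.not_eq_extremum)
qed

text \<open>
  The dilation about \<open>x0\<close> by the factor \<open>1 + l\<close> moves each point of the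
  \<open>t\<close>-neighbourhood, which is within \<open>R + t\<close> of \<open>x0\<close>, by at most \<open>l (R + t)\<close>. So
  the dilated neighbourhood is contained in the neighbourhood of radius \<open>t + s\<close>.
\<close>

lemma emeasure_nbhd_dilate:
  fixes N :: "'a::euclidean_space \<Rightarrow> real"
  assumes N: "is_norm N" and x0: "x0 \<in> A" and R: "\<And>y. y \<in> A \<Longrightarrow> N (y - x0) \<le> R"
    and l: "0 \<le> l" "l * (R + t) \<le> s"
  shows "ennreal ((1 + l) ^ DIM('a)) * emeasure lebesgue (nbhd N A t)
           \<le> emeasure lebesgue (nbhd N A (t + s))"
proof -
  let ?f = "\<lambda>z. (1 + l) *\<^sub>R z + (- l) *\<^sub>R x0"
  have "?f z \<in> nbhd N A (t + s)" if z: "z \<in> nbhd N A t" for z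
  proof -
    obtain y where y: "y \<in> A" "N (z - y) < t" using z by (auto simp: nbhd_def)
    have f: "?f z - y = (z - y) + l *\<^sub>R (z - x0)" by (simp add: algebra_simps)
    have "N (?f z - y) \<le> N (z - y) + l * N (z - x0)"
      using is_norm_triangle[OF N, of "z - y" "l *\<^sub>R (z - x0)"] l(1)
      unfolding f is_norm_scaleR[OF N] by simp
    also have "l * N (z - x0) \<le> l * (R + t)"
      using is_norm_triangle_diff[OF N, of z x0 y] y(2) R[OF y(1)] l(1)
      by (intro mult_left_mono) auto
    finally have "N (?f z - y) < t + s" using y(2) l(2) by linarith
    then show ?thesis using y(1) by (auto simp: nbhd_def)
  qed
  then have "emeasure lebesgue (?f ` nbhd N A t) \<le> emeasure lebesgue (nbhd N A (t + s))"
    by (intro emeasure_mono sets_nbhd[OF N]) auto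
  then show ?thesis using emeasure_lebesgue_affine[of "1 + l" "(- l) *\<^sub>R x0" "nbhd N A t"] l(1)
    by simp
qed

lemma emeasure_nbhd_singleton:
  fixes N :: "'a::euclidean_space \<Rightarrow> real"
  assumes N: "is_norm N" and t: "t > 0"
  shows "emeasure lebesgue (nbhd N {y} t) = ennreal (t ^ DIM('a)) * emeasure lebesgue (nbhd N {0} 1)"
proof -
  have "nbhd N {y} t = (\<lambda>z. t *\<^sub>R z + y) ` nbhd N {0} 1"
  proof (intro equalityI subsetI)
    fix z assume "z \<in> nbhd N {y} t"
    then have "N (z - y) < t" by (simp add: nbhd_def)
    then have "N ((z - y) /\<^sub>R t) < 1"
      using t unfolding is_norm_scaleR[OF N] by (simp add: field_simps)
    then have "z = t *\<^sub>R ((z - y) /\<^sub>R t) + y" "(z - y) /\<^sub>R t \<in> nbhd N {0} 1"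
      using t by (simp_all add: nbhd_def)
    then show "z \<in> (\<lambda>z. t *\<^sub>R z + y) ` nbhd N {0} 1" by blast
  qed (use t in \<open>auto simp: nbhd_def is_norm_scaleR[OF N]\<close>)
  then show ?thesis using emeasure_lebesgue_affine[of t y "nbhd N {0} 1"] t by simp
qed

lemma emeasure_unit_ball_pos:
  fixes N :: "'a::euclidean_space \<Rightarrow> real"
  assumes N: "is_norm N"
  shows "emeasure lebesgue (nbhd N {0} 1) > 0"
proof -
  have "0 \<in> nbhd N {0} 1" using is_norm_zero[OF N] by (simp add: nbhd_def)
  then have "nbhd N {0} 1 \<noteq> {}" by blast
  then have "\<not> negligible (nbhd N {0} 1)"
    using open_not_negligible[OF open_nbhd[OF N]] by blast
  then show ?thesis
    using sets_nbhd[OF N] by (auto simp: negligible_iff_null_sets null_sets_def zero_less_iff_neq_zero)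
qed

section \<open>Separated clusters in a set of small ultrametric distortion\<close>

text \<open>
  In an ultrametric space, being at distance at most \<open>r\<close> is transitive; the clusters are the
  classes of this equivalence relation.
\<close>

lemma ultrametric_clusters:
  assumes \<rho>: "ultrametric_on X \<rho>" and U: "U \<subseteq> X" and r: "0 \<le> r"
  obtains P where "partition_on U P"
    "\<And>C x y. C \<in> P \<Longrightarrow> x \<in> C \<Longrightarrow> y \<in> C \<Longrightarrow> \<rho> x y \<le> r"
    "\<And>C C' x y. C \<in> P \<Longrightarrow> C' \<in> P \<Longrightarrow> C \<noteq> C' \<Longrightarrow> x \<in> C \<Longrightarrow> y \<in> C' \<Longrightarrow> r < \<rho> x y"
proof -
  interpret Metric_space X \<rho> using \<rho> by (simp add: ultrametric_on_def)
  let ?E = "{(x, y). x \<in> U \<and> y \<in> U \<and> \<rho> x y \<le> r}"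
  have ult: "\<rho> x y \<le> max (\<rho> x z) (\<rho> y z)" if "x \<in> U" "y \<in> U" "z \<in> U" for x y z
    using \<rho> U that by (auto simp: ultrametric_on_def subset_iff)
  have E: "equiv U ?E"
  proof (rule equivI)
    show "refl_on U ?E" using U r by (auto simp: refl_on_def)
    show "sym ?E" by (auto simp: sym_def commute)
    show "trans ?E" 
    proof (rule transI, clarsimp)
      fix x y z assume "x \<in> U" "y \<in> U" "z \<in> U" "\<rho> x y \<le> r" "\<rho> y z \<le> r"
      then show "\<rho> x z \<le> r" using ult[of x z y] by (simp add: commute[of z y])
    qed
  qed auto
  show thesis
  proof
    show "partition_on U (U // ?E)" by (rule partition_on_quotient[OF E])
    show "\<rho> x y \<le> r" if "C \<in> U // ?E" "x \<in> C" "y \<in> C" for C x y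
      using quotient_eq_iff[OF E that(1,1,2,3)] by simp
    show "r < \<rho> x y" if "C \<in> U // ?E" "C' \<in> U // ?E" "C \<noteq> C'" "x \<in> C" "y \<in> C'" for C C' x y
      using quotient_eq_iff[OF E that(1,2,4,5)] that in_quotient_imp_subset[OF E that(1)]
        in_quotient_imp_subset[OF E that(2)] by auto
  qed
qed

text \<open>
  The separation makes the open neighbourhoods of the parts disjoint. A second countable space
  has only countably many disjoint nonempty open sets, and measure is countably additive.
\<close>

lemma emeasure_nbhd_partition:
  fixes N :: "'a::euclidean_space \<Rightarrow> real"
  assumes N: "is_norm N" and P: "partition_on U P" and t: "0 < t"
    and sep: "\<And>C C' x y. C \<in> P \<Longrightarrow> C' \<in> P \<Longrightarrow> C \<noteq> C' \<Longrightarrow> x \<in> C \<Longrightarrow> y \<in> C' \<Longrightarrow> 2 * t \<le> N (x - y)"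
  shows "countable P"
    and "emeasure lebesgue (nbhd N U t) = (\<integral>\<^sup>+C. emeasure lebesgue (nbhd N C t) \<partial>count_space P)"
proof -
  have disj: "nbhd N C t \<inter> nbhd N C' t = {}" if "C \<in> P" "C' \<in> P" "C \<noteq> C'" for C C'
  proof -
    have False if "x \<in> C" "y \<in> C'" "N (z - x) < t" "N (z - y) < t" for x y z
      using sep[OF \<open>C \<in> P\<close> \<open>C' \<in> P\<close> \<open>C \<noteq> C'\<close> that(1,2)] that(3,4)
        is_norm_triangle_diff[OF N, of x y z] is_norm_minus_commute[OF N, of x z] by linarith
    then show ?thesis by (auto simp: nbhd_def)
  qed
  have ne: "nbhd N C t \<noteq> {}" if "C \<in> P" for C
  proof -
    obtain x where "x \<in> C" using P \<open>C \<in> P\<close> by (fastforce simp: partition_on_def)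
    then have "x \<in> nbhd N C t" using t is_norm_zero[OF N] by (auto simp: nbhd_def intro!: bexI[of _ x])
    then show ?thesis by blast
  qed
  have "countable ((\<lambda>C. nbhd N C t) ` P)"
    using disj open_nbhd[OF N]
    by (intro countable_disjoint_open_subsets) (auto simp: pairwise_def disjnt_def)
  moreover have "inj_on (\<lambda>C. nbhd N C t) P"
    using disj ne by (fastforce intro!: inj_onI)
  ultimately show c: "countable P" by (rule countable_image_inj_on)
  have "nbhd N U t = (\<Union>C\<in>P. nbhd N C t)"
    using P by (metis nbhd_Union partition_on_def)
  then show "emeasure lebesgue (nbhd N U t) = (\<integral>\<^sup>+C. emeasure lebesgue (nbhd N C t) \<partial>count_space P)"
    using emeasure_UN_countable[OF sets_nbhd[OF N] c, of "\<lambda>C. C" "\<lambda>_. t"] disj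
    by (simp add: disjoint_family_on_def)
qed

text \<open>
  The \<open>\<rho>\<close>-clusters of radius \<open>2 K t\<close>: the lower bound on \<open>\<rho>\<close> controls their
  diameter in the norm, the upper bound turns their separation \<open>2 K t\<close> into \<open>2 t\<close>.
\<close>

lemma norm_clusters:
  fixes N :: "'a::euclidean_space \<Rightarrow> real"
  assumes N: "is_norm N" and \<rho>: "ultrametric_on X \<rho>" and U: "U \<subseteq> X" and t: "0 < t" and K: "0 < K"
    and bnd: "\<And>x y. x \<in> X \<Longrightarrow> y \<in> X \<Longrightarrow> N (x - y) \<le> \<rho> x y \<and> \<rho> x y \<le> K * N (x - y)"
  obtains P where "partition_on U P"
    "\<And>C x y. C \<in> P \<Longrightarrow> x \<in> C \<Longrightarrow> y \<in> C \<Longrightarrow> N (x - y) \<le> 2 * K * t"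
    "\<And>C C' x y. C \<in> P \<Longrightarrow> C' \<in> P \<Longrightarrow> C \<noteq> C' \<Longrightarrow> x \<in> C \<Longrightarrow> y \<in> C' \<Longrightarrow> 2 * t \<le> N (x - y)"
proof -
  obtain P where P: "partition_on U P"
    "\<And>C x y. C \<in> P \<Longrightarrow> x \<in> C \<Longrightarrow> y \<in> C \<Longrightarrow> \<rho> x y \<le> 2 * K * t"
    "\<And>C C' x y. C \<in> P \<Longrightarrow> C' \<in> P \<Longrightarrow> C \<noteq> C' \<Longrightarrow> x \<in> C \<Longrightarrow> y \<in> C' \<Longrightarrow> 2 * K * t < \<rho> x y"
    using ultrametric_clusters[OF \<rho> U, of "2 * K * t"] t K by auto
  have sub: "x \<in> X" if "C \<in> P" "x \<in> C" for C x
    using that P(1) U by (auto simp: partition_on_def)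
  show thesis
  proof (rule that[OF P(1)])
    fix C x y assume "C \<in> P" "x \<in> C" "y \<in> C"
    then show "N (x - y) \<le> 2 * K * t" using bnd[of x y] sub P(2)[of C x y] by fastforce
  next
    fix C C' x y assume *: "C \<in> P" "C' \<in> P" "C \<noteq> C'" "x \<in> C" "y \<in> C'"
    then have "K * (2 * t) \<le> K * N (x - y)" using bnd[of x y] sub P(3)[OF *] by fastforce
    then show "2 * t \<le> N (x - y)" using K by simp
  qed
qed

text \<open>
  The weighted inequality between geometric and arithmetic mean of \<open>q\<close> and \<open>1\<close>.
\<close>

lemma powr_le_Bernoulli:
  fixes q a :: real
  assumes "1 \<le> q" "0 \<le> a" "a \<le> 1"
  shows "q powr a \<le> 1 + a * (q - 1)"
  using Youngs_inequality_0[of a "1 - a" q 1] assms by (simp add: algebra_simps)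

text \<open>
  The clusters are taken at the larger scale \<open>q t\<close>, so that the neighbourhoods of both radii
  split into disjoint pieces. Each piece grows by the stated factor, by dilation about one of the
  points of its cluster.
\<close>

lemma emeasure_nbhd_growth:
  fixes N :: "'a::euclidean_space \<Rightarrow> real"
  assumes N: "is_norm N" and \<rho>: "ultrametric_on X \<rho>" and U: "U \<subseteq> X" and K: "0 < K"
    and bnd: "\<And>x y. x \<in> X \<Longrightarrow> y \<in> X \<Longrightarrow> N (x - y) \<le> \<rho> x y \<and> \<rho> x y \<le> K * N (x - y)"
    and t: "0 < t" and q: "1 \<le> q"
  shows "ennreal ((1 + (q - 1) / (2 * K * q + 1)) ^ DIM('a)) * emeasure lebesgue (nbhd N U t)
           \<le> emeasure lebesgue (nbhd N U (q * t))"
proof -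
  let ?l = "(q - 1) / (2 * K * q + 1)"
  let ?g = "ennreal ((1 + ?l) ^ DIM('a))"
  have qt: "0 < q * t" "t \<le> q * t" using t q by auto
  obtain P where P: "partition_on U P"
    and diam: "\<And>C x y. C \<in> P \<Longrightarrow> x \<in> C \<Longrightarrow> y \<in> C \<Longrightarrow> N (x - y) \<le> 2 * K * (q * t)"
    and sep: "\<And>C C' x y. C \<in> P \<Longrightarrow> C' \<in> P \<Longrightarrow> C \<noteq> C' \<Longrightarrow> x \<in> C \<Longrightarrow> y \<in> C' \<Longrightarrow>
                2 * (q * t) \<le> N (x - y)"
    using norm_clusters[OF N \<rho> U qt(1) K bnd] by blast
  have sep': "2 * t \<le> N (x - y)" if "C \<in> P" "C' \<in> P" "C \<noteq> C'" "x \<in> C" "y \<in> C'" for C C' x y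
    using sep[OF that] qt(2) by linarith
  have "?g * emeasure lebesgue (nbhd N C t) \<le> emeasure lebesgue (nbhd N C (q * t))" if C: "C \<in> P" for C
  proof -
    obtain x where x: "x \<in> C" using P C by (fastforce simp: partition_on_def)
    have "2 * K * q + 1 > 0" using K q by (simp add: add_pos_pos)
    moreover have "2 * K * (q * t) + t = (2 * K * q + 1) * t" by (simp add: algebra_simps)
    ultimately have "?l * (2 * K * (q * t) + t) \<le> (q - 1) * t" "0 \<le> ?l"
      using q by simp_all
    then show ?thesis
      using emeasure_nbhd_dilate[OF N x diam[OF C _ x], of ?l t "(q - 1) * t"]
      by (simp add: algebra_simps)
  qed
  then have le: "(\<integral>\<^sup>+C. ?g * emeasure lebesgue (nbhd N C t) \<partial>count_space P)
               \<le> (\<integral>\<^sup>+C. emeasure lebesgue (nbhd N C (q * t)) \<partial>count_space P)"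
    by (intro nn_integral_mono) simp
  have "?g * emeasure lebesgue (nbhd N U t) = (\<integral>\<^sup>+C. ?g * emeasure lebesgue (nbhd N C t) \<partial>count_space P)"
    using emeasure_nbhd_partition(2)[OF N P t sep'] by (simp add: nn_integral_cmult)
  also note le
  also have "(\<integral>\<^sup>+C. emeasure lebesgue (nbhd N C (q * t)) \<partial>count_space P) = emeasure lebesgue (nbhd N U (q * t))"
    by (rule emeasure_nbhd_partition(2)[OF N P qt(1) sep, symmetric])
  finally show ?thesis .
qed

section \<open>Covers and Hausdorff content\<close>

lemma ediam_le: "(\<And>x y. x \<in> A \<Longrightarrow> y \<in> A \<Longrightarrow> d x y \<le> r) \<Longrightarrow> ediam d A \<le> ennreal r"
  unfolding ediam_def by (intro SUP_least ennreal_leI)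

lemma epowr_le:
  assumes "t \<le> ennreal r" "0 \<le> r" "0 \<le> \<alpha>"
  shows "epowr t \<alpha> \<le> ennreal (r powr \<alpha>)"
proof -
  obtain u where u: "t = ennreal u" "0 \<le> u" "u \<le> r"
    using assms(1,2) by (cases t) (auto simp: top_unique)
  show ?thesis unfolding u(1) epowr_def using u assms(3) by (auto intro!: ennreal_leI powr_mono2)
qed

lemma epowr_ediam_empty: "epowr (ediam d {}) \<alpha> = 0"
  by (simp add: ediam_def epowr_def bot_ennreal)

text \<open>
  Hausdorff content is defined by covers that are sequences. A countable family becomes a
  sequence, without repeating any member, by placing each member at its code and the empty set,
  which costs nothing, elsewhere.
\<close>

lemma hausdorff_content_le_countable_cover:
  assumes P: "countable P" "\<Union>P = U"
  shows "hausdorff_content \<alpha> U d \<le> (\<integral>\<^sup>+C. epowr (ediam d C) \<alpha> \<partial>count_space P)"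
proof -
  let ?I = "to_nat_on P ` P"
  define A where "A i = (if i \<in> ?I then from_nat_into P i else {})" for i
  have AP: "A (to_nat_on P C) = C" if "C \<in> P" for C
    using that P(1) by (simp add: A_def)
  have sub: "A i \<subseteq> U" for i
    using P by (auto simp: A_def split: if_splits)
  have cover: "U \<subseteq> (\<Union>i. A i)"
  proof
    fix x assume "x \<in> U"
    then obtain C where "C \<in> P" "x \<in> C" using P(2) by blast
    then have "x \<in> A (to_nat_on P C)" using AP by simp
    then show "x \<in> (\<Union>i. A i)" by blast
  qed
  have "hausdorff_content \<alpha> U d \<le> (\<Sum>i. epowr (ediam d (A i)) \<alpha>)"
    unfolding hausdorff_content_def by (rule Inf_lower) (use sub cover in blast)
  also have "\<dots> = (\<integral>\<^sup>+i. epowr (ediam d (A i)) \<alpha> \<partial>count_space UNIV)"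
    by (simp add: nn_integral_count_space_nat)
  also have "\<dots> = (\<integral>\<^sup>+i. epowr (ediam d (A i)) \<alpha> \<partial>count_space ?I)"
    by (rule nn_integral_count_space_eq) (auto simp: A_def epowr_ediam_empty)
  also have "\<dots> = (\<integral>\<^sup>+C. epowr (ediam d (A (to_nat_on P C))) \<alpha> \<partial>count_space P)"
    by (rule nn_integral_bij_count_space[symmetric])
      (simp add: bij_betw_def inj_on_to_nat_on[OF P(1)])
  also have "\<dots> = (\<integral>\<^sup>+C. epowr (ediam d C) \<alpha> \<partial>count_space P)"
    by (rule nn_integral_cong) (simp add: AP)
  finally show ?thesis .
qed

text \<open>
  The usual \<open>\<epsilon> / 2 ^ (k + 1)\<close> argument.
\<close>

lemma hausdorff_content_countable_Union:
  fixes X :: "nat \<Rightarrow> 'a set"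
  assumes zero: "\<And>k. hausdorff_content \<alpha> (X k) d = 0"
  shows "hausdorff_content \<alpha> (\<Union>k. X k) d = 0"
proof -
  have "hausdorff_content \<alpha> (\<Union>k. X k) d \<le> ennreal e" if e: "0 < e" for e
  proof -
    define \<delta> where "\<delta> k = e * (1 / 2) ^ Suc k" for k
    have "\<exists>A. (\<forall>i. A i \<subseteq> X k) \<and> X k \<subseteq> (\<Union>i. A i)
               \<and> (\<Sum>i. epowr (ediam d (A i)) \<alpha>) < ennreal (\<delta> k)" for k
    proof -
      have "hausdorff_content \<alpha> (X k) d < ennreal (\<delta> k)"
        using zero e by (simp add: \<delta>_def)
      then show ?thesis unfolding hausdorff_content_def Inf_less_iff by blast
    qed
    then obtain A where A: "\<And>k i. A k i \<subseteq> X k" "\<And>k. X k \<subseteq> (\<Union>i. A k i)"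
      "\<And>k. (\<Sum>i. epowr (ediam d (A k i)) \<alpha>) < ennreal (\<delta> k)"
      by metis
    define B where "B m = A (fst (prod_decode m)) (snd (prod_decode m))" for m
    have "B m \<subseteq> (\<Union>k. X k)" for m using A(1) by (auto simp: B_def)
    moreover have "(\<Union>k. X k) \<subseteq> (\<Union>m. B m)"
    proof
      fix x assume "x \<in> (\<Union>k. X k)"
      then obtain k i where "x \<in> A k i" using A(2) by blast
      then have "x \<in> B (prod_encode (k, i))" by (simp add: B_def)
      then show "x \<in> (\<Union>m. B m)" by blast
    qed
    ultimately have "hausdorff_content \<alpha> (\<Union>k. X k) d \<le> (\<Sum>m. epowr (ediam d (B m)) \<alpha>)"
      unfolding hausdorff_content_def by (intro Inf_lower) blast
    also have "\<dots> = (\<Sum>k. \<Sum>i. epowr (ediam d (A k i)) \<alpha>)"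
      unfolding B_def
      by (rule suminf_ennreal_2dimen[where f="\<lambda>p. epowr (ediam d (A (fst p) (snd p))) \<alpha>"]) simp
    also have "\<dots> \<le> (\<Sum>k. ennreal (\<delta> k))"
      using A(3) by (intro suminf_le) (auto intro: less_imp_le)
    also have "\<dots> = ennreal e"
    proof (rule suminf_ennreal_eq)
      show "0 \<le> \<delta> k" for k using e by (simp add: \<delta>_def)
      show "\<delta> sums e" unfolding \<delta>_def using sums_mult[OF power_half_series, of e] by simp
    qed
    finally show ?thesis .
  qed
  then have "hausdorff_content \<alpha> (\<Union>k. X k) d \<le> 0"
    by - (rule ennreal_le_epsilon, simp)
  then show ?thesis by simp
qed

text \<open>
  The clusters at scale \<open>t\<close> form a cover in which each set costs at most
  \<open>(2 K t) powr \<alpha>\<close>. Their number is controlled by volume: each cluster contributes at least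
  a ball of radius \<open>t\<close> to the \<open>t\<close>-neighbourhood of \<open>U\<close>, and these contributions are
  disjoint.
\<close>

lemma hausdorff_content_le_emeasure_nbhd:
  fixes N :: "'a::euclidean_space \<Rightarrow> real"
  assumes N: "is_norm N" and \<rho>: "ultrametric_on X \<rho>" and U: "U \<subseteq> X" and K: "0 < K"
    and bnd: "\<And>x y. x \<in> X \<Longrightarrow> y \<in> X \<Longrightarrow> N (x - y) \<le> \<rho> x y \<and> \<rho> x y \<le> K * N (x - y)"
    and t: "0 < t" and \<alpha>: "0 \<le> \<alpha>"
  shows "hausdorff_content \<alpha> U (\<lambda>x y. N (x - y)) * (ennreal (t ^ DIM('a)) * emeasure lebesgue (nbhd N {0} 1))
           \<le> ennreal ((2 * K * t) powr \<alpha>) * emeasure lebesgue (nbhd N U t)"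
proof -
  let ?d = "\<lambda>x y. N (x - y)"
  let ?v = "ennreal (t ^ DIM('a)) * emeasure lebesgue (nbhd N {0} 1)"
  let ?c = "ennreal ((2 * K * t) powr \<alpha>)"
  obtain P where P: "partition_on U P"
    and diam: "\<And>C x y. C \<in> P \<Longrightarrow> x \<in> C \<Longrightarrow> y \<in> C \<Longrightarrow> N (x - y) \<le> 2 * K * t"
    and sep: "\<And>C C' x y. C \<in> P \<Longrightarrow> C' \<in> P \<Longrightarrow> C \<noteq> C' \<Longrightarrow> x \<in> C \<Longrightarrow> y \<in> C' \<Longrightarrow> 2 * t \<le> N (x - y)"
    using norm_clusters[OF N \<rho> U t K bnd] by blast
  have v: "?v \<le> emeasure lebesgue (nbhd N C t)" if C: "C \<in> P" for C
  proof -
    obtain x where x: "x \<in> C" using P C by (fastforce simp: partition_on_def)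
    then have "nbhd N {x} t \<subseteq> nbhd N C t" by (auto simp: nbhd_def)
    then show ?thesis
      unfolding emeasure_nbhd_singleton[OF N t, of x, symmetric] by (intro emeasure_mono sets_nbhd[OF N])
  qed
  have "hausdorff_content \<alpha> U ?d \<le> (\<integral>\<^sup>+C. epowr (ediam ?d C) \<alpha> \<partial>count_space P)"
    using P by (intro hausdorff_content_le_countable_cover emeasure_nbhd_partition(1)[OF N P t sep])
      (auto simp: partition_on_def)
  also have "\<dots> \<le> (\<integral>\<^sup>+C. ?c \<partial>count_space P)"
    using diam K t \<alpha> by (intro nn_integral_mono epowr_le ediam_le) auto
  finally have "hausdorff_content \<alpha> U ?d * ?v \<le> (\<integral>\<^sup>+C. ?c \<partial>count_space P) * ?v"
    by (rule mult_right_mono) simp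
  also have "\<dots> = ?c * (\<integral>\<^sup>+C. ?v \<partial>count_space P)"
    by (simp add: mult_ac)
  also have "\<dots> \<le> ?c * (\<integral>\<^sup>+C. emeasure lebesgue (nbhd N C t) \<partial>count_space P)"
    using v by (intro mult_left_mono nn_integral_mono) auto
  also have "\<dots> = ?c * emeasure lebesgue (nbhd N U t)"
    using emeasure_nbhd_partition(2)[OF N P t sep] by simp
  finally show ?thesis .
qed

section \<open>The dimension bound\<close>

lemma ennreal_geometric_bound_zero:
  fixes c M :: ennreal
  assumes w: "1 < w" and M: "M < \<infinity>" and le: "\<And>k. c * ennreal (w ^ k) \<le> M"
  shows "c = 0"
proof (rule ccontr)
  assume "c \<noteq> 0"
  have "c < \<infinity>" using le[of 0] M by (auto intro: le_less_trans)
  then obtain c' where c': "c = ennreal c'" "0 < c'"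
    using \<open>c \<noteq> 0\<close> by (cases c) (auto simp: less_le)
  obtain m where m: "M = ennreal m" "0 \<le> m" using M by (cases M) auto
  obtain k where "m / c' < w ^ k" using real_arch_pow[OF w] by blast
  then have "m < c' * w ^ k" using c'(2) by (simp add: field_simps)
  moreover have "c' * w ^ k \<le> m"
    using le[of k] c' m w by (simp add: ennreal_mult[symmetric])
  ultimately show False by simp
qed

text \<open>
  Iterating the growth of the neighbourhoods down the scales \<open>q ^ (- k)\<close> bounds their
  volume by a constant times \<open>q powr (- b k)\<close>, with \<open>q powr b\<close> at most the growth factor.
  Inserted into the covering bound, this gives content times \<open>q powr (k (b + \<alpha> - n))\<close> at
  most a constant for all \<open>k\<close>, where \<open>n\<close> is the dimension of the space.
  Since \<open>b + \<alpha> > n\<close>, this is possible only for content \<open>0\<close>.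
\<close>

lemma hausdorff_content_bounded_eq_0:
  fixes N :: "'a::euclidean_space \<Rightarrow> real" and b \<alpha> :: real
  assumes N: "is_norm N" and \<rho>: "ultrametric_on X \<rho>" and U: "U \<subseteq> X" "bounded U" and K: "0 < K"
    and bnd: "\<And>x y. x \<in> X \<Longrightarrow> y \<in> X \<Longrightarrow> N (x - y) \<le> \<rho> x y \<and> \<rho> x y \<le> K * N (x - y)"
    and q: "1 < q" and b: "q powr b \<le> (1 + (q - 1) / (2 * K * q + 1)) ^ DIM('a)"
    and \<alpha>: "0 < \<alpha>" "DIM('a) < b + \<alpha>"
  shows "hausdorff_content \<alpha> U (\<lambda>x y. N (x - y)) = 0"
proof -
  let ?H = "hausdorff_content \<alpha> U (\<lambda>x y. N (x - y))"
  let ?v = "emeasure lebesgue (nbhd N {0} 1)"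
  define f where "f t = emeasure lebesgue (nbhd N U t)" for t
  define w where "w = q powr (b + \<alpha> - DIM('a))"
  have growth: "ennreal (q powr b) * f t \<le> f (q * t)" if t: "0 < t" for t
  proof -
    have "ennreal (q powr b) * f t \<le> ennreal ((1 + (q - 1) / (2 * K * q + 1)) ^ DIM('a)) * f t"
      by (intro mult_right_mono ennreal_leI b) simp
    also have "\<dots> \<le> f (q * t)"
      unfolding f_def using emeasure_nbhd_growth[OF N \<rho> U(1) K bnd t, of q] q by simp
    finally show ?thesis .
  qed
  have decay: "ennreal ((q powr b) ^ k) * f ((1 / q) ^ k) \<le> f 1" for k
  proof (induction k)
    case (Suc k)
    have "ennreal ((q powr b) ^ Suc k) * f ((1 / q) ^ Suc k)
            = ennreal ((q powr b) ^ k) * (ennreal (q powr b) * f ((1 / q) ^ Suc k))"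
      by (simp add: ennreal_mult mult_ac)
    also have "\<dots> \<le> ennreal ((q powr b) ^ k) * f (q * (1 / q) ^ Suc k)"
      using q by (intro mult_left_mono growth) auto
    also have "\<dots> = ennreal ((q powr b) ^ k) * f ((1 / q) ^ k)" using q by simp
    finally show ?case using Suc by simp
  qed simp
  have "?H * ?v * ennreal (w ^ k) \<le> ennreal ((2 * K) powr \<alpha>) * f 1" for k
  proof -
    define t where "t = (1 / q) ^ k"
    \<comment> \<open>the factor by which the covering bound at scale \<open>t\<close> is multiplied: one part
      undoes the decay of \<open>f\<close>, the other cancels \<open>t powr \<alpha>\<close>\<close>
    let ?u = "(q powr b) ^ k * (q powr \<alpha>) ^ k"
    have t: "0 < t" using q by (simp add: t_def)
    have "w = (1 / q) ^ DIM('a) * (q powr b * q powr \<alpha>)"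
      using q by (simp add: w_def powr_diff powr_add powr_realpow power_one_over)
    then have w: "w ^ k = t ^ DIM('a) * ?u"
      by (simp add: t_def power_mult_distrib power_mult[symmetric] mult.commute)
    have "(q powr \<alpha>) ^ k = (q powr \<alpha>) powr real k"
      using q by (subst powr_realpow) auto
    also have "\<dots> = (q powr real k) powr \<alpha>" by (simp add: powr_powr mult.commute)
    also have "\<dots> = inverse t powr \<alpha>"
      using q by (simp add: t_def power_one_over powr_realpow)
    finally have "t powr \<alpha> * (q powr \<alpha>) ^ k = 1"
      using t by (simp add: powr_mult[symmetric])
    then have "(2 * K) powr \<alpha> * (q powr b) ^ k * (t powr \<alpha> * (q powr \<alpha>) ^ k)
                 = (2 * K) powr \<alpha> * (q powr b) ^ k"
      by (simp only: mult_1_right)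
    then have u: "(2 * K * t) powr \<alpha> * ?u = (2 * K) powr \<alpha> * (q powr b) ^ k"
      unfolding powr_mult[of "2 * K" t \<alpha>] by (simp only: mult_ac)
    have "?H * ?v * ennreal (w ^ k) = ?H * (ennreal (t ^ DIM('a)) * ?v) * ennreal ?u"
      using t unfolding w by (simp add: ennreal_mult mult_ac)
    also have "\<dots> \<le> ennreal ((2 * K * t) powr \<alpha>) * f t * ennreal ?u"
      unfolding f_def using hausdorff_content_le_emeasure_nbhd[OF N \<rho> U(1) K bnd t, of \<alpha>] \<alpha>(1)
      by (intro mult_right_mono) auto
    also have "\<dots> = ennreal ((2 * K * t) powr \<alpha> * ?u) * f t"
      by (simp add: ennreal_mult mult_ac)
    also have "\<dots> = ennreal ((2 * K) powr \<alpha>) * (ennreal ((q powr b) ^ k) * f t)"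
      unfolding u by (simp add: ennreal_mult mult_ac)
    also have "\<dots> \<le> ennreal ((2 * K) powr \<alpha>) * f 1"
      unfolding t_def by (intro mult_left_mono decay) simp
    finally show ?thesis .
  qed
  moreover have "1 < w" using q \<alpha>(2) by (simp add: w_def)
  moreover have "ennreal ((2 * K) powr \<alpha>) * f 1 < \<infinity>"
    using emeasure_nbhd_finite[OF N U(2), of 1] by (simp add: f_def ennreal_mult_less_top)
  ultimately have "?H * ?v = 0" using ennreal_geometric_bound_zero by blast
  moreover have "?v \<noteq> 0" using emeasure_unit_ball_pos[OF N] by (rule less_imp_neq[symmetric])
  ultimately show ?thesis by (simp only: mult_eq_0_iff simp_thms)
qed

theorem theorem1:
  fixes D :: real
    and N :: "real ^ 'n \<Rightarrow> real"
    and S :: "(real ^ 'n) set"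
  assumes "D > 1"
    and "is_norm N"
    and "ultrametric_distortion S (\<lambda>x y. N (x - y)) \<le> ereal D"
  shows "hausdorff_dim S (\<lambda>x y. N (x - y))
           \<le> ereal ((1 - 1 / (2 * (D + 1))) * real CARD('n))"
proof -
  let ?d = "\<lambda>x y. N (x - y)"
  \<comment> \<open>The infimum in the distortion need not be attained, so some \<open>K > D\<close> is required;
    any \<open>K < D + 1/2\<close> leaves room for \<open>q > 1\<close> with \<open>2 K q + 1 = 2 (D + 1)\<close>.\<close>
  define K where "K = D + 1 / 4"
  define q where "q = (2 * D + 1) / (2 * K)"
  define a where "a = 1 / (2 * (D + 1))"
  have K: "0 < K" and q: "1 < q" and a: "0 \<le> a" "a < 1"
    using assms(1) by (auto simp: K_def q_def a_def)
  have qK: "2 * K * q + 1 = 2 * (D + 1)" using K by (simp add: q_def)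
  have "ultrametric_distortion S ?d < ereal K"
    using assms(3) by (rule le_less_trans) (simp add: K_def)
  then obtain D' \<rho> where D': "D' < K" "ultrametric_on S \<rho>"
    "\<And>x y. x \<in> S \<Longrightarrow> y \<in> S \<Longrightarrow> N (x - y) \<le> \<rho> x y \<and> \<rho> x y \<le> D' * N (x - y)"
    unfolding ultrametric_distortion_def Inf_less_iff by auto
  have bnd: "N (x - y) \<le> \<rho> x y \<and> \<rho> x y \<le> K * N (x - y)" if "x \<in> S" "y \<in> S" for x y
    using D'(3)[OF that] mult_right_mono[OF less_imp_le[OF D'(1)] is_norm_nonneg[OF assms(2), of "x - y"]]
    by linarith
  have "q powr (a * CARD('n)) = (q powr a) ^ CARD('n)"
    unfolding powr_powr[symmetric] using q by (intro powr_realpow) simp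
  also have "\<dots> \<le> (1 + (q - 1) / (2 * K * q + 1)) ^ CARD('n)"
    using powr_le_Bernoulli[of q a] q a unfolding qK by (intro power_mono) (auto simp: a_def)
  finally have b: "q powr (a * CARD('n)) \<le> (1 + (q - 1) / (2 * K * q + 1)) ^ DIM(real ^ 'n)"
    by simp
  have zero: "hausdorff_content \<alpha> S ?d = 0" if \<alpha>: "(1 - a) * CARD('n) < \<alpha>" for \<alpha>
  proof -
    have "0 < (1 - a) * CARD('n)" using a by simp
    then have "0 < \<alpha>" using \<alpha> by linarith
    moreover have "DIM(real ^ 'n) < a * CARD('n) + \<alpha>" using \<alpha> by (simp add: algebra_simps)
    ultimately have "hausdorff_content \<alpha> (S \<inter> cball 0 (real k)) ?d = 0" for k
      by (intro hausdorff_content_bounded_eq_0[OF assms(2) D'(2) _ _ K bnd q b]) auto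
    then have "hausdorff_content \<alpha> (\<Union>k. S \<inter> cball 0 (real k)) ?d = 0"
      by (rule hausdorff_content_countable_Union)
    moreover have "(\<Union>k. S \<inter> cball 0 (real k)) = S"
      using real_arch_simple by (auto simp: dist_norm)
    ultimately show ?thesis by simp
  qed
  show ?thesis
  proof (rule ccontr)
    assume "\<not> ?thesis"
    then have "ereal ((1 - a) * CARD('n)) < hausdorff_dim S ?d" by (simp add: a_def not_le)
    then obtain \<alpha> where \<alpha>: "ereal ((1 - a) * CARD('n)) < ereal \<alpha>" "ereal \<alpha> < hausdorff_dim S ?d"
      using ereal_dense2 by blast
    moreover have "0 \<le> (1 - a) * CARD('n)" using a by simp
    ultimately have "0 < \<alpha>" by simp
    then have "hausdorff_dim S ?d \<le> ereal \<alpha>"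
      unfolding hausdorff_dim_def using zero \<alpha>(1) by (intro Inf_lower) auto
    then show False using \<alpha>(2) by simp
  qed
qed

end
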